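(* Let $a>0$, let $W=(W_t)_{t\ge 0}$ be the canonical process on the path space $C(\mathbb{R}^+,\mathbb{R})$ under Wiener measure $P$, let $(\mathcal{F}_t)_{t\ge0}$ be the usual $P$-augmentation of the canonical filtration of $W$, and let $\mathcal{F}'_t \equiv \mathcal{F}_{t+a}$ for $t\ge 0$. Then the process $W$ is not a semimartingale in the filtration $(\mathcal{F}'_t)_{t\ge0}$.
   Context: $P$ is Wiener measure, so $W$ is a standard Brownian motion started at $0$. The constant $a>0$ is fixed and represents the amount of foresight. "Semimartingale" has its standard meaning with respect to the filtration $(\mathcal{F}'_t)$ and the measure $P$. *)

theory Defs
  imports "HOL-Probability.Probability"
begin

text \<open>Time runs over the nonnegative reals; a process or filtration is a function of a real
  index whose values at negative indices are irrelevant to the definitions below.\<close>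

section \<open>Path space, canonical process and Wiener measure\<close>

text \<open>Extensionality fixes the junk values at negative times, so these functions are in bijection
  with the continuous functions on the half-line.\<close>

definition path_space :: "(real \<Rightarrow> real) set" where
  "path_space = {w \<in> extensional {0..}. continuous_on {0..} w}"

definition canonical_process :: "real \<Rightarrow> (real \<Rightarrow> real) \<Rightarrow> real" where
  "canonical_process t w = w t"

text \<open>Only the \<open>\<sigma>\<close>-algebra of the restricted product space is used: it is the one generated by
  the coordinate maps, equivalently the Borel \<open>\<sigma>\<close>-algebra for locally uniform convergence.\<close>

definition wiener_measure :: "(real \<Rightarrow> real) measure \<Rightarrow> bool" where
  "wiener_measure P \<longleftrightarrow>
     prob_space P \<and>
     sets P = sets (restrict_space (\<Pi>\<^sub>M t\<in>{0..}. borel) path_space) \<and>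
     (AE w in P. canonical_process 0 w = 0) \<and>
     (\<forall>s t. 0 \<le> s \<and> s < t \<longrightarrow>
        distributed P lborel (\<lambda>w. canonical_process t w - canonical_process s w)
          (normal_density 0 (sqrt (t - s)))) \<and>
     (\<forall>(n::nat) (u::nat \<Rightarrow> real). 0 \<le> u 0 \<and> mono u \<longrightarrow>
        prob_space.indep_vars P (\<lambda>_. borel)
          (\<lambda>i w. canonical_process (u (Suc i)) w - canonical_process (u i) w) {..<n})"

section \<open>Filtrations\<close>

definition natural_filtration :: "'a set \<Rightarrow> (real \<Rightarrow> 'a \<Rightarrow> real) \<Rightarrow> real \<Rightarrow> 'a measure" where
  "natural_filtration \<Omega> X t = sigma \<Omega> (\<Union>s\<in>{0..t}. sets (vimage_algebra \<Omega> (X s) borel))"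

text \<open>Null sets are those of the completion, i.e. all subsets of measurable \<open>P\<close>-null sets.\<close>

definition usual_augmentation ::
    "'a measure \<Rightarrow> (real \<Rightarrow> 'a measure) \<Rightarrow> real \<Rightarrow> 'a measure" where
  "usual_augmentation P F t =
     sigma (space P) (\<Inter>s\<in>{t<..}. sigma_sets (space P) (sets (F s) \<union> null_sets (completion P)))"

section \<open>Semimartingales\<close>

definition adapted_process :: "(real \<Rightarrow> 'a measure) \<Rightarrow> (real \<Rightarrow> 'a \<Rightarrow> real) \<Rightarrow> bool" where
  "adapted_process F X \<longleftrightarrow> (\<forall>t\<ge>0. X t \<in> borel_measurable (F t))"

definition cadlag :: "(real \<Rightarrow> real) \<Rightarrow> bool" where
  "cadlag f \<longleftrightarrow>
     (\<forall>t\<ge>0. (f \<longlongrightarrow> f t) (at_right t)) \<and> (\<forall>t>0. \<exists>l. (f \<longlongrightarrow> l) (at_left t))"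

definition locally_finite_variation :: "(real \<Rightarrow> real) \<Rightarrow> bool" where
  "locally_finite_variation f \<longleftrightarrow>
     (\<forall>t\<ge>0. \<exists>B. \<forall>(n::nat) (u::nat \<Rightarrow> real). mono u \<and> range u \<subseteq> {0..t} \<longrightarrow>
        (\<Sum>i<n. \<bar>f (u (Suc i)) - f (u i)\<bar>) \<le> B)"

definition martingale ::
    "'a measure \<Rightarrow> (real \<Rightarrow> 'a measure) \<Rightarrow> (real \<Rightarrow> 'a \<Rightarrow> real) \<Rightarrow> bool" where
  "martingale M F X \<longleftrightarrow>
     adapted_process F X \<and>
     (\<forall>t\<ge>0. integrable M (X t)) \<and>
     (\<forall>s t. 0 \<le> s \<and> s \<le> t \<longrightarrow> (AE \<omega> in M. real_cond_exp M (F s) (X t) \<omega> = X s \<omega>))"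

definition stopped_process ::
    "(real \<Rightarrow> 'a \<Rightarrow> real) \<Rightarrow> ('a \<Rightarrow> ennreal) \<Rightarrow> real \<Rightarrow> 'a \<Rightarrow> real" where
  "stopped_process X T t \<omega> = X (enn2real (min (ennreal t) (T \<omega>))) \<omega>"

text \<open>Stopping times take values in \<open>[0,\<infinity>]\<close>, so the filtration is reindexed by extended nonnegative reals.
  The index \<open>\<infinity>\<close> is sent to time 0, which is harmless: the condition there is that the whole space
  is measurable.\<close>

definition localizing_sequence ::
    "'a measure \<Rightarrow> (real \<Rightarrow> 'a measure) \<Rightarrow> (nat \<Rightarrow> 'a \<Rightarrow> ennreal) \<Rightarrow> bool" where
  "localizing_sequence M F T \<longleftrightarrow>
     (\<forall>n. stopping_time (\<lambda>s. F (enn2real s)) (T n)) \<and>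
     (AE \<omega> in M. incseq (\<lambda>n. T n \<omega>) \<and> (\<lambda>n. T n \<omega>) \<longlonglongrightarrow> \<infinity>)"

definition local_martingale_null ::
    "'a measure \<Rightarrow> (real \<Rightarrow> 'a measure) \<Rightarrow> (real \<Rightarrow> 'a \<Rightarrow> real) \<Rightarrow> bool" where
  "local_martingale_null M F X \<longleftrightarrow>
     adapted_process F X \<and>
     (\<forall>\<omega>\<in>space M. cadlag (\<lambda>t. X t \<omega>) \<and> X 0 \<omega> = 0) \<and>
     (\<exists>T. localizing_sequence M F T \<and> (\<forall>n. martingale M F (stopped_process X (T n))))"

definition finite_variation_null ::
    "'a measure \<Rightarrow> (real \<Rightarrow> 'a measure) \<Rightarrow> (real \<Rightarrow> 'a \<Rightarrow> real) \<Rightarrow> bool" where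
  "finite_variation_null M F A \<longleftrightarrow>
     adapted_process F A \<and>
     (\<forall>\<omega>\<in>space M.
        cadlag (\<lambda>t. A t \<omega>) \<and> locally_finite_variation (\<lambda>t. A t \<omega>) \<and> A 0 \<omega> = 0)"

text \<open>The decomposition is required up to indistinguishability.\<close>

definition semimartingale ::
    "'a measure \<Rightarrow> (real \<Rightarrow> 'a measure) \<Rightarrow> (real \<Rightarrow> 'a \<Rightarrow> real) \<Rightarrow> bool" where
  "semimartingale M F X \<longleftrightarrow>
     adapted_process F X \<and>
     (\<forall>\<omega>\<in>space M. cadlag (\<lambda>t. X t \<omega>)) \<and>
     (\<exists>N A. local_martingale_null M F N \<and> finite_variation_null M F A \<and>
        (AE \<omega> in M. \<forall>t\<ge>0. X t \<omega> = X 0 \<omega> + N t \<omega> + A t \<omega>))"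

section \<open>The augmented filtration is a filtration of the completed space\<close>

lemma natural_filtration_generator_closed:
  "(\<Union>s\<in>{0..t}. sets (vimage_algebra \<Omega> (X s) borel)) \<subseteq> Pow \<Omega>"
  using sets.space_closed[of "vimage_algebra \<Omega> (X _) borel"] by auto

lemma space_natural_filtration [simp]: "space (natural_filtration \<Omega> X t) = \<Omega>"
  unfolding natural_filtration_def
  by (rule space_measure_of[OF natural_filtration_generator_closed])

lemma sets_natural_filtration:
  "sets (natural_filtration \<Omega> X t) =
     sigma_sets \<Omega> (\<Union>s\<in>{0..t}. sets (vimage_algebra \<Omega> (X s) borel))"
  unfolding natural_filtration_def
  by (rule sets_measure_of[OF natural_filtration_generator_closed])

lemma sets_natural_filtration_mono:
  "s \<le> t \<Longrightarrow> sets (natural_filtration \<Omega> X s) \<subseteq> sets (natural_filtration \<Omega> X t)"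
  unfolding sets_natural_filtration by (intro sigma_sets_mono' UN_mono) auto

lemma natural_filtration_adapted:
  assumes "0 \<le> t" shows "X t \<in> borel_measurable (natural_filtration \<Omega> X t)"
proof (rule measurableI)
  fix A :: "real set" assume "A \<in> sets borel"
  then have "X t -` A \<inter> \<Omega> \<in> sets (vimage_algebra \<Omega> (X t) borel)"
    by (rule in_vimage_algebra)
  then show "X t -` A \<inter> space (natural_filtration \<Omega> X t) \<in> sets (natural_filtration \<Omega> X t)"
    using assms by (auto simp: sets_natural_filtration intro!: sigma_sets.Basic)
qed simp

lemma augmentation_generator_closed:
  assumes "space (F s) = space P"
  shows "sets (F s) \<union> null_sets (completion P) \<subseteq> Pow (space P)"
  using sets.sets_into_space[of _ "F s"] sets.sets_into_space[of _ "completion P"] assms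
  by (auto simp: null_sets_def)

lemma space_usual_augmentation [simp]:
  assumes "\<And>s. space (F s) = space P"
  shows "space (usual_augmentation P F t) = space P"
  unfolding usual_augmentation_def
proof (rule space_measure_of, rule subsetI)
  fix A assume "A \<in> (\<Inter>s\<in>{t<..}. sigma_sets (space P) (sets (F s) \<union> null_sets (completion P)))"
  then have "A \<in> sigma_sets (space P) (sets (F (t + 1)) \<union> null_sets (completion P))" by simp
  then show "A \<in> Pow (space P)"
    using sigma_sets_into_sp[OF augmentation_generator_closed[of F, OF assms]] by blast
qed

lemma sets_usual_augmentation:
  assumes "\<And>s. space (F s) = space P"
  shows "sets (usual_augmentation P F t) =
    (\<Inter>s\<in>{t<..}. sigma_sets (space P) (sets (F s) \<union> null_sets (completion P)))"
proof -
  let ?G = "\<lambda>s. sigma_sets (space P) (sets (F s) \<union> null_sets (completion P))"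
  have G: "sigma_algebra (space P) (?G s)" for s
    by (rule sigma_algebra_sigma_sets[OF augmentation_generator_closed[of F, OF assms]])
  have into: "?G s \<subseteq> Pow (space P)" for s
    using sigma_sets_into_sp[OF augmentation_generator_closed[of F, OF assms]] by blast
  have sub: "(\<Inter>s\<in>{t<..}. ?G s) \<subseteq> Pow (space P)"
    using into[of "t + 1"] by (meson INF_lower2 greaterThan_iff less_add_one)
  have "sigma_sets (space P) (\<Inter>s\<in>{t<..}. ?G s) \<subseteq> ?G s" if "t < s" for s
    by (rule sigma_algebra.sigma_sets_subset[OF G]) (use that in auto)
  then have "sigma_sets (space P) (\<Inter>s\<in>{t<..}. ?G s) = (\<Inter>s\<in>{t<..}. ?G s)"
    by (intro antisym INF_greatest subsetI sigma_sets.Basic) auto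
  then show ?thesis
    unfolding usual_augmentation_def by (simp add: sets_measure_of[OF sub])
qed

lemma filtration_usual_augmentation:
  assumes "\<And>s. space (F s) = space P"
  shows "filtration (space P) (usual_augmentation P F)"
  by standard (auto simp: assms sets_usual_augmentation)

lemma subalgebra_usual_augmentation:
  assumes sp: "\<And>s. space (F s) = space P" and F: "\<And>s. sets (F s) \<subseteq> sets P"
  shows "subalgebra (completion P) (usual_augmentation P F t)"
proof -
  have "sigma_sets (space P) (sets (F s) \<union> null_sets (completion P)) \<subseteq> sets (completion P)" for s
    using sets.sigma_sets_subset[of "sets (F s) \<union> null_sets (completion P)" "completion P"] F[of s]
    by (auto simp: null_sets_def)
  then have "sets (usual_augmentation P F t) \<subseteq> sets (completion P)"
    unfolding sets_usual_augmentation[where F=F and P=P, OF sp]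
    by (meson INF_lower2 greaterThan_iff less_add_one)
  then show ?thesis by (simp add: subalgebra_def sp)
qed

lemma sets_subset_usual_augmentation:
  assumes sp: "\<And>s. space (F s) = space P" and mono: "\<And>s t. s \<le> t \<Longrightarrow> sets (F s) \<subseteq> sets (F t)"
  shows "sets (F t) \<subseteq> sets (usual_augmentation P F t)"
  unfolding sets_usual_augmentation[where F=F and P=P, OF sp]
  using mono by (auto intro!: sigma_sets.Basic dest: less_imp_le)

section \<open>The canonical process in the anticipating filtration\<close>

lemma wiener_space: "wiener_measure P \<Longrightarrow> space P = path_space"
  unfolding wiener_measure_def
  by (auto dest!: sets_eq_imp_space_eq simp: space_restrict_space space_PiM path_space_def
      PiE_def)

lemma natural_filtration_canonical_subset:
  assumes "wiener_measure P"
  shows "sets (natural_filtration (space P) canonical_process t) \<subseteq> sets P"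
  unfolding sets_natural_filtration
proof (rule sets.sigma_sets_subset, safe)
  fix s A assume s: "s \<in> {0..t}"
    and A: "A \<in> sets (vimage_algebra (space P) (canonical_process s) borel)"
  have "(\<lambda>w. w s) \<in> borel_measurable (\<Pi>\<^sub>M t\<in>{0..}. borel)"
    using s by (intro measurable_component_singleton) auto
  then have "(\<lambda>w. w s) \<in> borel_measurable (restrict_space (\<Pi>\<^sub>M t\<in>{0..}. borel) path_space)"
    by (rule measurable_restrict_space1)
  then have "canonical_process s \<in> borel_measurable P"
    using assms unfolding wiener_measure_def canonical_process_def[abs_def]
    by (subst measurable_cong_sets[OF _ refl]) auto
  then show "A \<in> sets P"
    using A by (auto simp: sets_vimage_algebra2 measurable_sets)
qed

lemma anticipating_filtration:
  assumes "wiener_measure P"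
  shows "filtration (space (completion P))
      (\<lambda>t. usual_augmentation P (natural_filtration (space P) canonical_process) (t + a))"
    and "subalgebra (completion P)
      (usual_augmentation P (natural_filtration (space P) canonical_process) (t + a))"
  using filtration_usual_augmentation[of "natural_filtration (space P) canonical_process" P]
    subalgebra_usual_augmentation[of "natural_filtration (space P) canonical_process" P]
    natural_filtration_canonical_subset[OF assms]
  by (auto simp: filtration_def)

lemma canonical_process_adapted:
  assumes "0 \<le> a"
  shows "adapted_process
      (\<lambda>t. usual_augmentation P (natural_filtration (space P) canonical_process) (t + a))
      canonical_process"
  unfolding adapted_process_def
proof (intro allI impI)
  fix t :: real assume t: "0 \<le> t"
  let ?N = "natural_filtration (space P) canonical_process"
  have "sets (?N t) \<subseteq> sets (usual_augmentation P ?N (t + a))"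
    using sets_natural_filtration_mono[of t "t + a"] assms
      sets_subset_usual_augmentation[of ?N P, OF _ sets_natural_filtration_mono] by force
  then show "canonical_process t \<in> borel_measurable (usual_augmentation P ?N (t + a))"
    using natural_filtration_adapted[OF t, of canonical_process "space P"]
    by (auto simp: measurable_def)
qed

lemma canonical_process_cadlag:
  assumes "wiener_measure P" "w \<in> space P"
  shows "cadlag (\<lambda>t. canonical_process t w)"
proof -
  have w: "continuous_on {0..} w"
    using assms by (simp add: wiener_space path_space_def)
  have "(w \<longlongrightarrow> w t) (at_right t)" if "0 \<le> t" for t
  proof (rule tendsto_within_subset)
    show "(w \<longlongrightarrow> w t) (at t within {0..})" using w that by (simp add: continuous_on_def)
  qed (use that in auto)
  moreover have "(w \<longlongrightarrow> w t) (at_left t)" if "0 < t" for t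
  proof -
    have "isCont w t"
      by (rule continuous_on_interior[OF w]) (use that in simp)
    then show ?thesis unfolding isCont_def by (rule tendsto_within_subset) auto
  qed
  ultimately show ?thesis by (auto simp: cadlag_def canonical_process_def)
qed

end

theory Submission
  imports Defs "HOL-Real_Asymp.Real_Asymp"
begin

text \<open>
  On \<open>[0, a]\<close> the path of \<open>W\<close> is known at time 0 in the anticipating filtration, so the signs of its
  increments along a partition may be used as integrands. Suppose \<open>W = W\<^sub>0 + N + A\<close> with \<open>N\<close> a local
  martingale and \<open>A\<close> of finite variation. Integrate the sign of the increment over
  \<open>(t\<^sub>i, t\<^sub>i\<^sub>+\<^sub>1]\<close> against the stopped martingale, and quit as soon as \<open>N\<close> or the variation of \<open>A\<close> exceeds a
  level \<open>k\<close> or the localizing time is reached. The integral has mean 0, the contribution of \<open>A\<close> is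
  at most \<open>k\<close>, and the overshoot at the exit is controlled by the \<open>L\<^sup>1\<close> norm of the stopped martingale. Hence
  the variation of \<open>W\<close> along uniform partitions, restricted to an event of positive probability on
  which no exit occurs, has bounded expectation. For Brownian motion this variation over \<open>n\<close> steps has
  mean \<open>sqrt (2 a n / \<pi>)\<close> and variance at most \<open>a\<close>, a contradiction.
\<close>

section \<open>Discrete martingale integrals up to an exit\<close>

text \<open>A bounded \<open>F\<close>-measurable factor can be moved inside the conditional
  expectation. With \<open>h\<close> a predictable integrand this makes increments centred; with
  \<open>h\<close> a sign it yields the submartingale property of the absolute value.\<close>

lemma (in finite_measure) integral_mult_martingale_eq:
  assumes "subalgebra M F" and h: "h \<in> borel_measurable F" "\<And>\<omega>. \<bar>h \<omega>\<bar> \<le> (1::real)"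
    and int: "integrable M X" "integrable M Y"
    and ce: "AE \<omega> in M. real_cond_exp M F X \<omega> = Y \<omega>"
  shows "(\<integral>\<omega>. h \<omega> * X \<omega> \<partial>M) = (\<integral>\<omega>. h \<omega> * Y \<omega> \<partial>M)"
    and "integrable M (\<lambda>\<omega>. h \<omega> * X \<omega>)" "integrable M (\<lambda>\<omega>. h \<omega> * Y \<omega>)"
proof -
  interpret finite_measure_subalgebra M F by standard (rule assms)
  have hM: "h \<in> borel_measurable M" by (rule measurable_from_subalg[OF assms(1) h(1)])
  have *: "integrable M (\<lambda>\<omega>. h \<omega> * U \<omega>)" if "integrable M U" for U
    by (rule Bochner_Integration.integrable_bound[OF that])
      (use hM that h(2) in \<open>auto simp: abs_mult intro!: mult_left_le_one_le\<close>)
  show "integrable M (\<lambda>\<omega>. h \<omega> * X \<omega>)" "integrable M (\<lambda>\<omega>. h \<omega> * Y \<omega>)"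
    using * int by auto
  have "(\<integral>\<omega>. h \<omega> * X \<omega> \<partial>M) = (\<integral>\<omega>. h \<omega> * real_cond_exp M F X \<omega> \<partial>M)"
    using real_cond_exp_intg(2)[OF *[OF int(1)] h(1)] int by auto
  also have "\<dots> = (\<integral>\<omega>. h \<omega> * Y \<omega> \<partial>M)"
    by (rule integral_cong_AE) (use hM int ce in auto)
  finally show "(\<integral>\<omega>. h \<omega> * X \<omega> \<partial>M) = (\<integral>\<omega>. h \<omega> * Y \<omega> \<partial>M)" .
qed

text \<open>Survival up to \<open>Suc i\<close> is not known at \<open>i\<close>, so the sum itself
  need not be centred. With \<open>B i\<close> in place of \<open>B (Suc i)\<close> it is; the
  difference lives on the exit event of step \<open>i\<close>, where the increment is at most
  \<open>K\<close> plus the overshoot. Exit events are disjoint, so all overshoots together cost at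
  most the \<open>L^1\<close> norm of the terminal value.\<close>

lemma (in prob_space) elementary_integral_before_exit_bound:
  fixes G :: "nat \<Rightarrow> 'a measure" and X g :: "nat \<Rightarrow> 'a \<Rightarrow> real"
  assumes sub: "\<And>i. i \<le> n \<Longrightarrow> subalgebra M (G i)"
    and filt: "\<And>i. i < n \<Longrightarrow> sets (G i) \<subseteq> sets (G (Suc i))"
    and X: "\<And>i. i \<le> n \<Longrightarrow> X i \<in> borel_measurable (G i)" "\<And>i. i \<le> n \<Longrightarrow> integrable M (X i)"
    and mart: "\<And>i j. i \<le> j \<Longrightarrow> j \<le> n \<Longrightarrow> AE \<omega> in M. real_cond_exp M (G i) (X j) \<omega> = X i \<omega>"
    and B: "\<And>i. i \<le> n \<Longrightarrow> B i \<in> sets (G i)" "\<And>i. B (Suc i) \<subseteq> B i"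
    and g: "\<And>i. i < n \<Longrightarrow> g i \<in> borel_measurable (G i)" "\<And>i \<omega>. \<bar>g i \<omega>\<bar> \<le> 1"
    and K: "0 \<le> K" "\<And>i \<omega>. i \<le> n \<Longrightarrow> \<omega> \<in> B i \<Longrightarrow> \<bar>X i \<omega>\<bar> \<le> K"
  shows "integrable M (\<lambda>\<omega>. \<Sum>i<n. indicator (B (Suc i)) \<omega> * (g i \<omega> * (X (Suc i) \<omega> - X i \<omega>)))"
    and "expectation (\<lambda>\<omega>. \<Sum>i<n. indicator (B (Suc i)) \<omega> * (g i \<omega> * (X (Suc i) \<omega> - X i \<omega>)))
      \<le> K + expectation (\<lambda>\<omega>. \<bar>X n \<omega>\<bar>)"
proof -
  let ?d = "\<lambda>i \<omega>. g i \<omega> * (X (Suc i) \<omega> - X i \<omega>)"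
  define E where "E i = B i - B (Suc i)" for i
  have BM: "B i \<in> sets M" if "i \<le> n" for i
    using sub[OF that] B(1)[OF that] by (auto simp: subalgebra_def)
  have gM: "g i \<in> borel_measurable M" if "i < n" for i
    using measurable_from_subalg[OF sub g(1)[OF that]] that by simp
  have EG: "E i \<in> sets (G (Suc i))" and EM: "E i \<in> sets M" if "i < n" for i
    using B(1)[of "Suc i"] B(1)[of i] filt[of i] BM[of i] BM[of "Suc i"] that by (auto simp: E_def)
  have disj: "disjoint_family_on E {..<n}"
  proof -
    have mono: "B j \<subseteq> B i" if "i \<le> j" for i j
      using that by (induction rule: dec_induct) (use B(2) in auto)
    have "E i \<inter> E j = {}" if "i < j" for i j
      using mono[of "Suc i" j] that by (auto simp: E_def)
    then show ?thesis
      by (auto simp: disjoint_family_on_def) (metis disjoint_iff linorder_neqE_nat)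
  qed
  have ind_sum: "(\<Sum>i<n. indicator (E i) \<omega>) \<le> (1::real)" for \<omega>
  proof -
    have "(\<Sum>i<n. indicator (E i) \<omega>) = (indicator (\<Union>i<n. E i) \<omega> :: real)"
      by (rule indicator_UN_disjoint[OF _ disj, symmetric]) simp
    then show ?thesis by (simp add: indicator_def)
  qed
  have zero: "integrable M (\<lambda>\<omega>. indicator (B i) \<omega> * ?d i \<omega>)"
    "expectation (\<lambda>\<omega>. indicator (B i) \<omega> * ?d i \<omega>) = 0" if "i < n" for i
  proof -
    let ?h = "\<lambda>\<omega>. indicator (B i) \<omega> * g i \<omega>"
    have h: "?h \<in> borel_measurable (G i)" using B(1)[of i] g(1)[OF that] that by auto
    have h1: "\<bar>?h \<omega>\<bar> \<le> 1" for \<omega> using g(2)[of i \<omega>] by (auto simp: indicator_def)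
    note I = integral_mult_martingale_eq[OF sub h h1 X(2) X(2) mart]
    have eq: "indicator (B i) \<omega> * ?d i \<omega> = ?h \<omega> * X (Suc i) \<omega> - ?h \<omega> * X i \<omega>" for \<omega>
      by (simp add: algebra_simps)
    show "integrable M (\<lambda>\<omega>. indicator (B i) \<omega> * ?d i \<omega>)"
      "expectation (\<lambda>\<omega>. indicator (B i) \<omega> * ?d i \<omega>) = 0"
      unfolding eq using I[of "Suc i"] that by auto
  qed
  \<comment> \<open>The multiplier is the sign of \<open>X (Suc i)\<close> on \<open>E i\<close>,
    known at \<open>Suc i\<close>. Replacing \<open>X (Suc i)\<close> by \<open>X n\<close> then
    keeps the integral, and a sign times \<open>X n\<close> is at most its absolute value.\<close>
  have overshoot: "integrable M (\<lambda>\<omega>. indicator (E i) \<omega> * \<bar>X (Suc i) \<omega>\<bar>)"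
    "integrable M (\<lambda>\<omega>. indicator (E i) \<omega> * \<bar>X n \<omega>\<bar>)"
    "expectation (\<lambda>\<omega>. indicator (E i) \<omega> * \<bar>X (Suc i) \<omega>\<bar>)
      \<le> expectation (\<lambda>\<omega>. indicator (E i) \<omega> * \<bar>X n \<omega>\<bar>)" if "i < n" for i
  proof -
    let ?h = "\<lambda>\<omega>. indicator (E i) \<omega> * sgn (X (Suc i) \<omega>)"
    have h: "?h \<in> borel_measurable (G (Suc i))" using EG[OF that] X(1)[of "Suc i"] that by auto
    have h1: "\<bar>?h \<omega>\<bar> \<le> 1" for \<omega> by (auto simp: indicator_def sgn_if)
    note I = integral_mult_martingale_eq[OF sub h h1 X(2) X(2) mart, of n]
    have eq: "indicator (E i) \<omega> * \<bar>X (Suc i) \<omega>\<bar> = ?h \<omega> * X (Suc i) \<omega>" for \<omega>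
      by (simp add: abs_sgn)
    show "integrable M (\<lambda>\<omega>. indicator (E i) \<omega> * \<bar>X (Suc i) \<omega>\<bar>)"
      unfolding eq using I that by auto
    show i: "integrable M (\<lambda>\<omega>. indicator (E i) \<omega> * \<bar>X n \<omega>\<bar>)"
      using integrable_mult_indicator[OF EM[OF that] integrable_abs[OF X(2)[of n]]] by simp
    have "expectation (\<lambda>\<omega>. ?h \<omega> * X (Suc i) \<omega>) = expectation (\<lambda>\<omega>. ?h \<omega> * X n \<omega>)"
      using I that by auto
    also have "\<dots> \<le> expectation (\<lambda>\<omega>. indicator (E i) \<omega> * \<bar>X n \<omega>\<bar>)"
      by (rule integral_mono[OF _ i]) (use I that in \<open>auto simp: indicator_def sgn_if\<close>)
    finally show "expectation (\<lambda>\<omega>. indicator (E i) \<omega> * \<bar>X (Suc i) \<omega>\<bar>)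
      \<le> expectation (\<lambda>\<omega>. indicator (E i) \<omega> * \<bar>X n \<omega>\<bar>)"
      unfolding eq .
  qed
  have iE: "integrable M (indicator (E i) :: _ \<Rightarrow> real)" if "i < n" for i
    using EM[OF that] by (simp add: emeasure_eq_measure)
  show int: "integrable M (\<lambda>\<omega>. \<Sum>i<n. indicator (B (Suc i)) \<omega> * ?d i \<omega>)"
  proof (rule Bochner_Integration.integrable_sum)
    fix i assume "i \<in> {..<n}"
    then show "integrable M (\<lambda>\<omega>. indicator (B (Suc i)) \<omega> * ?d i \<omega>)"
      using B(2)[of i] BM[of "Suc i"] gM[of i] X(2)[of i] X(2)[of "Suc i"]
      by (intro Bochner_Integration.integrable_bound[OF zero(1)[of i]]) (auto simp: indicator_def)
  qed
  let ?U = "\<lambda>i \<omega>. indicator (B i) \<omega> * ?d i \<omega> + indicator (E i) \<omega> * \<bar>X (Suc i) \<omega>\<bar>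
    + K * indicator (E i) \<omega>"
  \<comment> \<open>On \<open>E i\<close> the left side is 0, while the centred term may be
    negative; the last two summands of \<open>?U\<close> compensate for it. Off \<open>E i\<close>
    the two indicators agree.\<close>
  have pt: "indicator (B (Suc i)) \<omega> * ?d i \<omega> \<le> ?U i \<omega>" if "i < n" for i \<omega>
  proof (cases "\<omega> \<in> E i")
    case True
    have "\<bar>?d i \<omega>\<bar> \<le> \<bar>X (Suc i) \<omega> - X i \<omega>\<bar>"
      using g(2)[of i \<omega>] by (auto simp: abs_mult intro!: mult_left_le_one_le)
    also have "\<dots> \<le> \<bar>X (Suc i) \<omega>\<bar> + K"
      using K(2)[of i \<omega>] that True by (auto simp: E_def)
    finally show ?thesis using True by (auto simp: E_def)
  next
    case False
    then show ?thesis using B(2)[of i] by (auto simp: E_def indicator_def)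
  qed
  have "expectation (\<lambda>\<omega>. \<Sum>i<n. indicator (B (Suc i)) \<omega> * ?d i \<omega>) \<le> expectation (\<lambda>\<omega>. \<Sum>i<n. ?U i \<omega>)"
  proof (rule integral_mono[OF int])
    show "integrable M (\<lambda>\<omega>. \<Sum>i<n. ?U i \<omega>)"
      using zero overshoot iE
      by (intro Bochner_Integration.integrable_sum Bochner_Integration.integrable_add) auto
    show "(\<Sum>i<n. indicator (B (Suc i)) \<omega> * ?d i \<omega>) \<le> (\<Sum>i<n. ?U i \<omega>)" for \<omega>
      by (intro sum_mono pt) simp
  qed
  also have "\<dots> = (\<Sum>i<n. expectation (\<lambda>\<omega>. indicator (E i) \<omega> * \<bar>X (Suc i) \<omega>\<bar>)
      + K * expectation (indicator (E i)))"
    using zero overshoot iE by (subst Bochner_Integration.integral_sum) auto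
  also have "\<dots> \<le> (\<Sum>i<n. expectation (\<lambda>\<omega>. indicator (E i) \<omega> * \<bar>X n \<omega>\<bar>)
      + K * expectation (indicator (E i)))"
    using overshoot(3) by (intro sum_mono) auto
  also have "\<dots> = expectation (\<lambda>\<omega>. \<Sum>i<n. indicator (E i) \<omega> * \<bar>X n \<omega>\<bar> + K * indicator (E i) \<omega>)"
    using overshoot iE by (subst Bochner_Integration.integral_sum) auto
  also have "\<dots> = expectation (\<lambda>\<omega>. (\<Sum>i<n. indicator (E i) \<omega>) * \<bar>X n \<omega>\<bar> + K * (\<Sum>i<n. indicator (E i) \<omega>))"
    by (simp only: sum.distrib sum_distrib_right sum_distrib_left)
  also have "\<dots> \<le> expectation (\<lambda>\<omega>. \<bar>X n \<omega>\<bar> + K)"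
  proof (rule integral_mono')
    show "integrable M (\<lambda>\<omega>. \<bar>X n \<omega>\<bar> + K)" using X(2)[of n] by simp
    show "(\<Sum>i<n. indicator (E i) \<omega>) * \<bar>X n \<omega>\<bar> + K * (\<Sum>i<n. indicator (E i) \<omega>) \<le> \<bar>X n \<omega>\<bar> + K" for \<omega>
      using ind_sum[of \<omega>] K(1) by (intro add_mono mult_left_le_one_le mult_left_le) (auto intro: sum_nonneg)
  qed (use K in auto)
  also have "\<dots> = K + expectation (\<lambda>\<omega>. \<bar>X n \<omega>\<bar>)"
    using X(2)[of n] by (simp add: prob_space)
  finally show "expectation (\<lambda>\<omega>. \<Sum>i<n. indicator (B (Suc i)) \<omega> * ?d i \<omega>)
      \<le> K + expectation (\<lambda>\<omega>. \<bar>X n \<omega>\<bar>)" .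
qed

section \<open>Variation bound for a semimartingale foreseen on [0, a]\<close>

text \<open>Foresight is the assumption that \<open>X t\<close> is known at time 0 for
  \<open>t\<close> up to \<open>a\<close>. It makes the sign of each increment an admissible
  integrand, and integrating that sign against \<open>X\<close> recovers the variation along the
  grid. The point is that \<open>D\<close> and \<open>C\<close> do not depend on
  \<open>n\<close>.\<close>

lemma (in prob_space) foreseen_semimartingale_variation_bound:
  fixes F :: "real \<Rightarrow> 'a measure" and X :: "real \<Rightarrow> 'a \<Rightarrow> real"
  assumes a: "0 < a"
    and sub: "\<And>t. subalgebra M (F t)"
    and filt: "\<And>s t. s \<le> t \<Longrightarrow> sets (F s) \<subseteq> sets (F t)"
    and X0: "\<And>t. 0 \<le> t \<Longrightarrow> t \<le> a \<Longrightarrow> X t \<in> borel_measurable (F 0)"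
    and cont: "\<And>\<omega>. \<omega> \<in> space M \<Longrightarrow> continuous_on {0..a} (\<lambda>t. X t \<omega>)"
    and semi: "semimartingale M F X"
  obtains D C where "D \<in> sets M" "0 < prob D"
    "\<And>n. 0 < n \<Longrightarrow> expectation (\<lambda>\<omega>. indicator D \<omega> *
      (\<Sum>i<n. \<bar>X (a * real (Suc i) / real n) \<omega> - X (a * real i / real n) \<omega>\<bar>)) \<le> C"
proof -
  obtain N A where N: "local_martingale_null M F N" and A: "finite_variation_null M F A"
    and dec: "AE \<omega> in M. \<forall>t\<ge>0. X t \<omega> = X 0 \<omega> + N t \<omega> + A t \<omega>"
    using semi unfolding semimartingale_def by auto
  obtain T where T: "localizing_sequence M F T"
    and mart: "\<And>k. martingale M F (stopped_process N (T k))"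
    using N unfolding local_martingale_null_def by auto
  have spF: "space (F t) = space M" for t using sub by (simp add: subalgebra_def)
  have measF: "f \<in> borel_measurable (F t)" if "f \<in> borel_measurable (F s)" "s \<le> t" for f :: "'a \<Rightarrow> real" and s t
    using that filt[of s t] spF by (auto simp: measurable_def)
  have NF: "N t \<in> borel_measurable (F t)" if "0 \<le> t" for t
    using N that by (auto simp: local_martingale_null_def adapted_process_def)
  have AF: "A t \<in> borel_measurable (F t)" if "0 \<le> t" for t
    using A that by (auto simp: finite_variation_null_def adapted_process_def)
  have TF: "{\<omega> \<in> space M. ennreal t < T k \<omega>} \<in> sets (F t)" if "0 \<le> t" for t k
  proof -
    have "stopping_time (\<lambda>s. F (enn2real s)) (T k)" using T by (simp add: localizing_sequence_def)
    \<comment> \<open>At a finite index, \<open>enn2real\<close> undoes \<open>ennreal\<close>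
      because \<open>t\<close> is nonnegative.\<close>
    from stopping_timeD2[OF this, of "ennreal t"] that show ?thesis
      by (simp add: pred_def spF)
  qed
  define p where "p n i = a * real i / real n" for n i :: nat
  define V where "V n i \<omega> = (\<Sum>j<i. \<bar>A (p n (Suc j)) \<omega> - A (p n j) \<omega>\<bar>)" for n i \<omega>
  define Q where "Q k n i \<omega> \<longleftrightarrow> V n i \<omega> \<le> real k \<and> \<bar>N (p n i) \<omega>\<bar> \<le> real k" for k n i \<omega>
  \<comment> \<open>The conditions for all grids are imposed at once, so that one event serves every
    \<open>n\<close>. There are countably many of them, which keeps \<open>D k\<close>
    measurable.\<close>
  define D where "D k = {\<omega> \<in> space M. ennreal a < T k \<omega> \<and> (\<forall>n>0. \<forall>i\<le>n. Q k n i \<omega>)}" for k :: nat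
  have p0: "0 \<le> p n i" for n i using a by (simp add: p_def)
  have pmono: "p n i \<le> p n j" if "i \<le> j" for n i j
    using a that by (auto simp: p_def intro!: divide_right_mono mult_left_mono)
  have pa: "p n i \<le> a" if "i \<le> n" for n i
    using a that by (cases "n = 0") (auto simp: p_def field_simps)
  have VF: "V n i \<in> borel_measurable (F (p n j))" if "i \<le> j" for n i j
    unfolding V_def using that
    by (intro borel_measurable_sum borel_measurable_abs borel_measurable_diff measF[OF AF[OF p0]])
      (auto intro!: pmono)
  have NpF: "N (p n i) \<in> borel_measurable (F (p n j))" if "i \<le> j" for n i j
    by (rule measF[OF NF[OF p0] pmono[OF that]])
  have QF: "{\<omega> \<in> space M. Q k n i \<omega>} \<in> sets (F (p n j))" if "i \<le> j" for k n i j
  proof -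
    have [measurable]: "V n i \<in> borel_measurable (F (p n j))" "N (p n i) \<in> borel_measurable (F (p n j))"
      using VF NpF that by auto
    have "{\<omega> \<in> space (F (p n j)). Q k n i \<omega>} \<in> sets (F (p n j))" unfolding Q_def by measurable
    then show ?thesis by (simp add: spF)
  qed
  have FM: "S \<in> sets M" if "S \<in> sets (F t)" for S t
    using sub[of t] that by (auto simp: subalgebra_def)
  have DM: "D k \<in> sets M" for k
  proof -
    have [measurable]: "Measurable.pred M (\<lambda>\<omega>. ennreal a < T k \<omega>)" "Measurable.pred M (Q k n i)" for n i
      using FM[OF TF[of a k]] FM[OF QF[of i i k n]] a by (simp_all add: pred_def)
    show ?thesis unfolding D_def by measurable
  qed
  have cover: "AE \<omega> in M. \<exists>k. \<omega> \<in> D k"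
  proof -
    have "AE \<omega> in M. (\<lambda>k. T k \<omega>) \<longlonglongrightarrow> \<infinity>"
      using T by (auto simp: localizing_sequence_def)
    with dec AE_space show ?thesis
    proof eventually_elim
      case (elim \<omega>)
      have "eventually (\<lambda>k. ennreal a < T k \<omega>) sequentially"
        using order_tendstoD(1)[OF elim(3), of "ennreal a"] by simp
      then obtain k0 where k0: "\<And>k. k0 \<le> k \<Longrightarrow> ennreal a < T k \<omega>"
        by (auto simp: eventually_sequentially)
      have "locally_finite_variation (\<lambda>t. A t \<omega>)"
        using A elim by (simp add: finite_variation_null_def)
      then have "\<exists>b. \<forall>(n::nat) u. mono u \<and> range u \<subseteq> {0..a} \<longrightarrow>
          (\<Sum>i<n. \<bar>A (u (Suc i)) \<omega> - A (u i) \<omega>\<bar>) \<le> b"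
        unfolding locally_finite_variation_def using a by simp
      then obtain b where b: "\<And>(n::nat) u. mono u \<Longrightarrow> range u \<subseteq> {0..a} \<Longrightarrow>
          (\<Sum>i<n. \<bar>A (u (Suc i)) \<omega> - A (u i) \<omega>\<bar>) \<le> b"
        by blast
      have A0: "A 0 \<omega> = 0" using A elim by (simp add: finite_variation_null_def)
      \<comment> \<open>The one-step partition from 0 to \<open>t\<close> suffices, since
        \<open>A\<close> starts at 0.\<close>
      have Ab: "\<bar>A t \<omega>\<bar> \<le> b" if "0 \<le> t" "t \<le> a" for t
      proof -
        have "mono (\<lambda>i::nat. if i = 0 then 0 else t)" using that by (intro monoI) auto
        moreover have "range (\<lambda>i::nat. if i = 0 then 0 else t) \<subseteq> {0..a}" using that a by auto
        ultimately show ?thesis using b[of "\<lambda>i. if i = 0 then 0 else t" 1] A0 by simp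
      qed
      have "compact ((\<lambda>t. X t \<omega>) ` {0..a})"
        using cont elim by (intro compact_continuous_image) auto
      then have "\<exists>c. \<forall>t\<in>{0..a}. \<bar>X t \<omega>\<bar> \<le> c"
        using compact_imp_bounded[of "(\<lambda>t. X t \<omega>) ` {0..a}"] by (simp add: bounded_iff)
      then obtain c where c: "\<And>t. 0 \<le> t \<Longrightarrow> t \<le> a \<Longrightarrow> \<bar>X t \<omega>\<bar> \<le> c"
        by (meson atLeastAtMost_iff)
      \<comment> \<open>The bound on \<open>N\<close> comes from the decomposition: \<open>X\<close>
        is bounded by continuity on a compact interval, and \<open>A\<close> by its
        variation.\<close>
      have Nb: "\<bar>N t \<omega>\<bar> \<le> 2 * c + b" if "0 \<le> t" "t \<le> a" for t
      proof -
        have "X t \<omega> = X 0 \<omega> + N t \<omega> + A t \<omega>" using elim(1) that(1) by blast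
        then show ?thesis using c[of t] c[of 0] Ab[of t] that a by linarith
      qed
      \<comment> \<open>The definition of finite variation asks for monotone sequences on all of the
        naturals with range in the interval, so the grid is frozen after index
        \<open>n\<close>.\<close>
      have Vb: "V n i \<omega> \<le> b" if "i \<le> n" for n i
      proof -
        have "mono (\<lambda>j. p n (min j n))" by (auto intro!: monoI pmono)
        moreover have "range (\<lambda>j. p n (min j n)) \<subseteq> {0..a}" using p0 pa by auto
        ultimately have "(\<Sum>j<i. \<bar>A (p n (min (Suc j) n)) \<omega> - A (p n (min j n)) \<omega>\<bar>) \<le> b"
          by (rule b)
        moreover have "(\<Sum>j<i. \<bar>A (p n (min (Suc j) n)) \<omega> - A (p n (min j n)) \<omega>\<bar>) = V n i \<omega>"
          unfolding V_def using that by (intro sum.cong) (auto simp: min_def)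
        ultimately show ?thesis by simp
      qed
      obtain k where k: "k0 \<le> k" "b \<le> real k" "2 * c + b \<le> real k"
        using real_arch_simple[of "max (real k0) (max b (2 * c + b))"] by auto
      have "Q k n i \<omega>" if "i \<le> n" for n i
        unfolding Q_def using Vb[OF that] Nb[OF p0 pa[OF that]] k by (intro conjI) linarith+
      then have "\<omega> \<in> D k"
        using k0[OF k(1)] elim(2) by (simp add: D_def)
      then show ?case ..
    qed
  qed
  \<comment> \<open>Countably many null events could not cover almost every path.\<close>
  have "\<not> (\<forall>k. prob (D k) = 0)"
  proof
    assume "\<forall>k. prob (D k) = 0"
    then have "AE \<omega> in M. \<forall>k. \<omega> \<notin> D k"
      unfolding AE_all_countable using prob_eq_0[OF DM] by simp
    with cover have "AE \<omega> in M. False" by eventually_elim auto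
    then show False by simp
  qed
  then obtain k where k: "0 < prob (D k)" by (auto simp: zero_less_measure_iff)
  \<comment> \<open>One \<open>k\<close> bounds the martingale before the exit, the other the
    variation of \<open>A\<close>. The last grid point is always \<open>a\<close>, so the
    \<open>L^1\<close> norm is the same for every \<open>n\<close>.\<close>
  define C where "C = 2 * real k + expectation (\<lambda>\<omega>. \<bar>stopped_process N (T k) a \<omega>\<bar>)"
  have "expectation (\<lambda>\<omega>. indicator (D k) \<omega> * (\<Sum>i<n. \<bar>X (p n (Suc i)) \<omega> - X (p n i) \<omega>\<bar>)) \<le> C"
    if n: "0 < n" for n
  proof -
    define Y where "Y i = stopped_process N (T k) (p n i)" for i
    define g where "g i \<omega> = sgn (X (p n (Suc i)) \<omega> - X (p n i) \<omega>)" for i \<omega>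
    \<comment> \<open>No exit up to grid index \<open>i\<close>. The strict inequality with
      \<open>T k\<close> makes the event measurable at the current time and lets stopped and
      unstopped values coincide on it.\<close>
    define B where "B i = {\<omega> \<in> space M. ennreal (p n i) < T k \<omega>} \<inter> (\<Inter>j\<le>i. {\<omega> \<in> space M. Q k n j \<omega>})" for i
    have YN: "Y i \<omega> = N (p n i) \<omega>" if "\<omega> \<in> B i" for i \<omega>
      using that p0[of n i] by (simp add: Y_def B_def stopped_process_def min_absorb1 less_imp_le)
    have Ymart: "martingale M F (stopped_process N (T k))" by (rule mart)
    have Bdec: "B (Suc i) \<subseteq> B i" for i
    proof
      fix \<omega> assume \<omega>: "\<omega> \<in> B (Suc i)"
      have "ennreal (p n i) \<le> ennreal (p n (Suc i))" by (intro ennreal_leI pmono) simp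
      also have "\<dots> < T k \<omega>" using \<omega> by (simp add: B_def)
      finally show "\<omega> \<in> B i" using \<omega> by (simp add: B_def)
    qed
    \<comment> \<open>Foresight enters here: the endpoint value at \<open>Suc i\<close> is already
      known at time 0.\<close>
    have gF: "g i \<in> borel_measurable (F (p n i))" if "i < n" for i
    proof -
      have [measurable]: "X (p n (Suc i)) \<in> borel_measurable (F (p n i))" "X (p n i) \<in> borel_measurable (F (p n i))"
        using measF[OF X0[OF p0 pa] p0] that by auto
      show ?thesis unfolding g_def by measurable
    qed
    note bound = elementary_integral_before_exit_bound[of n "\<lambda>i. F (p n i)" Y B g "real k"]
    have pn: "p n n = a" using n by (simp add: p_def)
    have BF: "B i \<in> sets (F (p n i))" for i
      unfolding B_def using TF[OF p0] QF by (intro sets.Int sets.finite_INT) auto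
    have YB: "\<bar>Y i \<omega>\<bar> \<le> real k" if "\<omega> \<in> B i" for i \<omega>
      unfolding YN[OF that] using that by (auto simp: B_def Q_def)
    have pfilt: "sets (F (p n i)) \<subseteq> sets (F (p n (Suc i)))" for i by (intro filt pmono) simp
    have Y: "Y i \<in> borel_measurable (F (p n i))" "integrable M (Y i)" for i
      using Ymart p0[of n i] by (simp_all add: martingale_def adapted_process_def Y_def)
    have Yce: "AE \<omega> in M. real_cond_exp M (F (p n i)) (Y j) \<omega> = Y i \<omega>" if "i \<le> j" for i j
      using Ymart p0[of n i] pmono[OF that, of n] by (simp add: martingale_def Y_def)
    have g1: "\<bar>g i \<omega>\<bar> \<le> 1" for i \<omega> by (simp add: g_def sgn_if)
    have hyps: "integrable M (\<lambda>\<omega>. \<Sum>i<n. indicator (B (Suc i)) \<omega> * (g i \<omega> * (Y (Suc i) \<omega> - Y i \<omega>)))"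
      "expectation (\<lambda>\<omega>. \<Sum>i<n. indicator (B (Suc i)) \<omega> * (g i \<omega> * (Y (Suc i) \<omega> - Y i \<omega>)))
      \<le> real k + expectation (\<lambda>\<omega>. \<bar>Y n \<omega>\<bar>)"
      by (rule bound[OF sub pfilt Y Yce BF Bdec gF g1 of_nat_0_le_iff YB]; assumption)+
    let ?I = "\<lambda>\<omega>. \<Sum>i<n. indicator (B (Suc i)) \<omega> * (g i \<omega> * (Y (Suc i) \<omega> - Y i \<omega>))"
    \<comment> \<open>If \<open>Suc m\<close> is survived, the whole sum is at most the variation of
      \<open>A\<close> up to there, which is below the level \<open>k\<close>. Otherwise the last
      term vanishes and the induction hypothesis applies.\<close>
    have small: "(\<Sum>i<m. indicator (B (Suc i)) \<omega> * \<bar>A (p n (Suc i)) \<omega> - A (p n i) \<omega>\<bar>) \<le> real k" for m \<omega>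
    proof (induction m)
      case (Suc m)
      show ?case
      proof (cases "\<omega> \<in> B (Suc m)")
        case True
        have "(\<Sum>i<Suc m. indicator (B (Suc i)) \<omega> * \<bar>A (p n (Suc i)) \<omega> - A (p n i) \<omega>\<bar>) \<le> V n (Suc m) \<omega>"
          unfolding V_def by (intro sum_mono) (auto simp: indicator_def)
        also have "\<dots> \<le> real k" using True by (auto simp: B_def Q_def)
        finally show ?thesis .
      next
        case False
        then show ?thesis using Suc by simp
      qed
    qed simp
    have DB: "D k \<subseteq> B i" if "i \<le> n" for i
    proof
      fix \<omega> assume \<omega>: "\<omega> \<in> D k"
      have "ennreal (p n i) \<le> ennreal a" by (rule ennreal_leI[OF pa[OF that]])
      also have "\<dots> < T k \<omega>" using \<omega> by (simp add: D_def)
      finally show "\<omega> \<in> B i" using \<omega> n that by (auto simp: D_def B_def)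
    qed
    \<comment> \<open>On \<open>D k\<close> no exit occurs, so its indicator may be replaced
      termwise by those of the events \<open>B (Suc i)\<close>. There the increment of
      \<open>X\<close> splits into those of \<open>Y\<close> and \<open>A\<close>.\<close>
    have ae: "AE \<omega> in M. indicator (D k) \<omega> * (\<Sum>i<n. \<bar>X (p n (Suc i)) \<omega> - X (p n i) \<omega>\<bar>)
        \<le> ?I \<omega> + real k"
      using dec
    proof eventually_elim
      case (elim \<omega>)
      have "indicator (D k) \<omega> * (\<Sum>i<n. \<bar>X (p n (Suc i)) \<omega> - X (p n i) \<omega>\<bar>)
        \<le> (\<Sum>i<n. indicator (B (Suc i)) \<omega> * \<bar>X (p n (Suc i)) \<omega> - X (p n i) \<omega>\<bar>)"
        unfolding sum_distrib_left
      proof (intro sum_mono mult_right_mono)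
        fix i assume "i \<in> {..<n}"
        then show "indicator (D k) \<omega> \<le> (indicator (B (Suc i)) \<omega> :: real)"
          using DB[of "Suc i"] by (auto simp: indicator_def)
      qed simp
      also have "\<dots> \<le> (\<Sum>i<n. indicator (B (Suc i)) \<omega> * (g i \<omega> * (Y (Suc i) \<omega> - Y i \<omega>))
          + indicator (B (Suc i)) \<omega> * \<bar>A (p n (Suc i)) \<omega> - A (p n i) \<omega>\<bar>)"
      proof (rule sum_mono)
        fix i
        show "indicator (B (Suc i)) \<omega> * \<bar>X (p n (Suc i)) \<omega> - X (p n i) \<omega>\<bar> \<le>
          indicator (B (Suc i)) \<omega> * (g i \<omega> * (Y (Suc i) \<omega> - Y i \<omega>))
          + indicator (B (Suc i)) \<omega> * \<bar>A (p n (Suc i)) \<omega> - A (p n i) \<omega>\<bar>"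
        proof (cases "\<omega> \<in> B (Suc i)")
          case True
          have *: "\<bar>x\<bar> \<le> sgn x * u + \<bar>v\<bar>" if "x = u + v" for x u v :: real
            using that by (auto simp: sgn_if)
          have Y: "Y (Suc i) \<omega> = N (p n (Suc i)) \<omega>" "Y i \<omega> = N (p n i) \<omega>"
            using YN True Bdec by auto
          have "X (p n (Suc i)) \<omega> = X 0 \<omega> + N (p n (Suc i)) \<omega> + A (p n (Suc i)) \<omega>"
            "X (p n i) \<omega> = X 0 \<omega> + N (p n i) \<omega> + A (p n i) \<omega>"
            using elim p0 by blast+
          then have "\<bar>X (p n (Suc i)) \<omega> - X (p n i) \<omega>\<bar> \<le> g i \<omega> * (Y (Suc i) \<omega> - Y i \<omega>)
              + \<bar>A (p n (Suc i)) \<omega> - A (p n i) \<omega>\<bar>"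
            unfolding Y g_def by (intro *) simp
          then show ?thesis using True by simp
        qed simp
      qed
      also have "\<dots> \<le> ?I \<omega> + real k" using small by (simp add: sum.distrib)
      finally show ?case .
    qed
    have "expectation (\<lambda>\<omega>. indicator (D k) \<omega> * (\<Sum>i<n. \<bar>X (p n (Suc i)) \<omega> - X (p n i) \<omega>\<bar>))
      \<le> expectation (\<lambda>\<omega>. ?I \<omega> + real k)"
    \<comment> \<open>Only the dominating function has to be integrable and nonnegative; the latter
      holds because it dominates a variation.\<close>
    proof (rule integral_mono_AE'[OF _ ae])
      show "integrable M (\<lambda>\<omega>. ?I \<omega> + real k)" using hyps by simp
      show "AE \<omega> in M. 0 \<le> ?I \<omega> + real k"
        using ae
      proof eventually_elim
        case (elim \<omega>)
        have "0 \<le> indicator (D k) \<omega> * (\<Sum>i<n. \<bar>X (p n (Suc i)) \<omega> - X (p n i) \<omega>\<bar>)"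
          by (intro mult_nonneg_nonneg sum_nonneg) auto
        then show ?case using elim by (rule order_trans)
      qed
    qed
    also have "\<dots> \<le> C" using hyps by (simp add: C_def prob_space Y_def pn)
    finally show ?thesis .
  qed
  then show ?thesis by (intro that[of "D k" C] DM k) (simp add: p_def)
qed

section \<open>Brownian variation along uniform grids\<close>

text \<open>Cross terms vanish, since each new variable is centred and independent of the sum of the
  others. The application is to centred absolute increments.\<close>

lemma (in prob_space) expectation_sum_power2_indep:
  fixes X :: "'i \<Rightarrow> 'a \<Rightarrow> real"
  assumes "finite I"
    and "indep_vars (\<lambda>_. borel) X I"
    and "\<And>i. i \<in> I \<Longrightarrow> integrable M (\<lambda>\<omega>. (X i \<omega>)\<^sup>2)"
    and "\<And>i. i \<in> I \<Longrightarrow> expectation (X i) = 0"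
  shows "integrable M (\<lambda>\<omega>. (\<Sum>i\<in>I. X i \<omega>)\<^sup>2)"
    and "expectation (\<lambda>\<omega>. (\<Sum>i\<in>I. X i \<omega>)\<^sup>2) = (\<Sum>i\<in>I. expectation (\<lambda>\<omega>. (X i \<omega>)\<^sup>2))"
proof -
  have "integrable M (\<lambda>\<omega>. (\<Sum>i\<in>I. X i \<omega>)\<^sup>2) \<and>
    expectation (\<lambda>\<omega>. (\<Sum>i\<in>I. X i \<omega>)\<^sup>2) = (\<Sum>i\<in>I. expectation (\<lambda>\<omega>. (X i \<omega>)\<^sup>2))"
    using assms
  proof (induction I rule: finite_induct)
    case empty
    then show ?case by simp
  next
    case (insert i I)
    let ?S = "\<lambda>\<omega>. \<Sum>j\<in>I. X j \<omega>"
    have rv: "random_variable borel (X j)" if "j \<in> insert i I" for j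
      using insert.prems(1) that by (auto simp: indep_vars_def)
    have int: "integrable M (X j)" if "j \<in> insert i I" for j
      using square_integrable_imp_integrable[OF rv[OF that] insert.prems(2)[OF that]] .
    have IH: "integrable M (\<lambda>\<omega>. (?S \<omega>)\<^sup>2)"
      "expectation (\<lambda>\<omega>. (?S \<omega>)\<^sup>2) = (\<Sum>i\<in>I. expectation (\<lambda>\<omega>. (X i \<omega>)\<^sup>2))"
      using insert.IH[OF indep_vars_subset[OF insert.prems(1)]] insert.prems by auto
    have S: "integrable M ?S" "expectation ?S = 0"
      using int insert.prems(3) by (auto simp: Bochner_Integration.integral_sum)
    have ind: "indep_var borel (X i) borel ?S"
      by (rule indep_vars_sum[OF insert.hyps insert.prems(1)])
    have prod: "integrable M (\<lambda>\<omega>. X i \<omega> * ?S \<omega>)" "expectation (\<lambda>\<omega>. X i \<omega> * ?S \<omega>) = 0"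
      using indep_var_integrable[OF ind int S(1)] indep_var_lebesgue_integral[OF ind int S(1)] S(2)
      by auto
    have eq: "(\<lambda>\<omega>. (\<Sum>j\<in>insert i I. X j \<omega>)\<^sup>2) =
        (\<lambda>\<omega>. (X i \<omega>)\<^sup>2 + 2 * (X i \<omega> * ?S \<omega>) + (?S \<omega>)\<^sup>2)"
      using insert.hyps by (simp add: power2_sum mult.assoc add.commute add.left_commute)
    show ?case
      unfolding eq using insert.hyps insert.prems(2) IH prod by simp
  qed
  then show "integrable M (\<lambda>\<omega>. (\<Sum>i\<in>I. X i \<omega>)\<^sup>2)"
    "expectation (\<lambda>\<omega>. (\<Sum>i\<in>I. X i \<omega>)\<^sup>2) = (\<Sum>i\<in>I. expectation (\<lambda>\<omega>. (X i \<omega>)\<^sup>2))"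
    by auto
qed

lemma (in prob_space) normal_abs_moments:
  assumes "0 < \<sigma>" and D: "distributed M lborel X (normal_density 0 \<sigma>)"
  shows "integrable M (\<lambda>\<omega>. \<bar>X \<omega>\<bar>)" and "expectation (\<lambda>\<omega>. \<bar>X \<omega>\<bar>) = \<sigma> * sqrt (2 / pi)"
    and "integrable M (\<lambda>\<omega>. (X \<omega>)\<^sup>2)" and "expectation (\<lambda>\<omega>. (X \<omega>)\<^sup>2) = \<sigma>\<^sup>2"
proof -
  show "integrable M (\<lambda>\<omega>. \<bar>X \<omega>\<bar>)"
    using distributed_integrable[OF D, of "\<lambda>x. \<bar>x\<bar>"] integrable_normal_moment_abs[OF assms(1), of 0 1]
    by simp
  show "expectation (\<lambda>\<omega>. \<bar>X \<omega>\<bar>) = \<sigma> * sqrt (2 / pi)"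
    using distributed_integral[OF D, of "\<lambda>x. \<bar>x\<bar>"] integral_normal_moment_abs_odd[OF assms(1), of 0 0]
    by simp
  show "integrable M (\<lambda>\<omega>. (X \<omega>)\<^sup>2)"
    using distributed_integrable[OF D, of "\<lambda>x. x\<^sup>2"] integrable_normal_moment[OF assms(1), of 0 2]
    by simp
  show "expectation (\<lambda>\<omega>. (X \<omega>)\<^sup>2) = \<sigma>\<^sup>2"
    using distributed_integral[OF D, of "\<lambda>x. x\<^sup>2"] integral_normal_moment_even[OF assms(1), of 0 1]
    by simp
qed

text \<open>The centred variation \<open>S\<close> has second moment at most \<open>a\<close> for
  every \<open>n\<close>. Restricting it to any event therefore lowers the integral by no more than
  \<open>(1 + a) / 2\<close>, because \<open>-S\<close> is at most \<open>(1 + S^2) / 2\<close>,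
  whereas the mean grows like the square root of \<open>n\<close>.\<close>

lemma wiener_abs_increments_lower_bound:
  assumes P: "wiener_measure P" and a: "0 < a" and n: "0 < n"
    and D: "D \<in> sets (completion P)"
  shows "measure (completion P) D * sqrt (2 * a * real n / pi) - (1 + a) / 2 \<le>
    (\<integral>w. indicator D w * (\<Sum>i<n. \<bar>canonical_process (a * real (Suc i) / real n) w
       - canonical_process (a * real i / real n) w\<bar>) \<partial>completion P)"
proof -
  interpret prob_space P using P by (simp add: wiener_measure_def)
  interpret C: prob_space "completion P" by (rule prob_space_completion)
  define \<sigma> where "\<sigma> = sqrt (a / real n)"
  define \<mu> where "\<mu> = \<sigma> * sqrt (2 / pi)"
  define X where "X i w = canonical_process (a * real (Suc i) / real n) w
       - canonical_process (a * real i / real n) w" for i w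
  define Z where "Z i w = \<bar>X i w\<bar> - \<mu>" for i w
  have \<sigma>: "0 < \<sigma>" using a n by (simp add: \<sigma>_def)
  have dist: "distributed P lborel (X i) (normal_density 0 \<sigma>)" for i
  proof -
    have "distributed P lborel (X i)
      (normal_density 0 (sqrt (a * real (Suc i) / real n - a * real i / real n)))"
      unfolding X_def using P a n unfolding wiener_measure_def by (simp add: divide_strict_right_mono)
    then show ?thesis
      by (simp add: \<sigma>_def diff_divide_distrib[symmetric] algebra_simps)
  qed
  note mom = normal_abs_moments[OF \<sigma> dist]
  have "mono (\<lambda>i. a * real i / real n)"
    using a n by (auto intro!: monoI divide_right_mono mult_left_mono)
  then have "indep_vars (\<lambda>_. borel) X {..<n}"
    using P a spec[of "\<lambda>u. 0 \<le> u 0 \<and> mono u \<longrightarrow> indep_vars (\<lambda>_. borel)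
      (\<lambda>i w. canonical_process (u (Suc i)) w - canonical_process (u i) w) {..<n}"
      "\<lambda>i. a * real i / real n"]
    unfolding wiener_measure_def X_def by simp
  then have ind: "indep_vars (\<lambda>_. borel) Z {..<n}"
    unfolding Z_def by (rule indep_vars_compose2) auto
  have Zsq: "(\<lambda>w. (Z i w)\<^sup>2) = (\<lambda>w. (X i w)\<^sup>2 - 2 * \<mu> * \<bar>X i w\<bar> + \<mu>\<^sup>2)" for i
    by (auto simp: Z_def power2_diff)
  \<comment> \<open>The variance of the absolute increment is
    \<open>\<sigma>^2 - \<mu>^2\<close>.\<close>
  have Z2: "integrable P (\<lambda>w. (Z i w)\<^sup>2)" "expectation (\<lambda>w. (Z i w)\<^sup>2) \<le> \<sigma>\<^sup>2" for i
    unfolding Zsq using mom[of i] by (auto simp: prob_space \<mu>_def power2_eq_square)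
  have Z1: "integrable P (Z i)" "expectation (Z i) = 0" for i
    using mom[of i] by (auto simp: Z_def[abs_def] \<mu>_def prob_space)
  let ?S = "\<lambda>w. \<Sum>i<n. Z i w"
  have S2: "integrable P (\<lambda>w. (?S w)\<^sup>2)"
    "expectation (\<lambda>w. (?S w)\<^sup>2) = (\<Sum>i<n. expectation (\<lambda>w. (Z i w)\<^sup>2))"
    using expectation_sum_power2_indep[OF _ ind] Z1 Z2 by auto
  have "(\<Sum>i<n. expectation (\<lambda>w. (Z i w)\<^sup>2)) \<le> (\<Sum>i<n. \<sigma>\<^sup>2)"
    by (intro sum_mono Z2)
  also have "\<dots> = a" using a n by (simp add: \<sigma>_def)
  finally have Sa: "expectation (\<lambda>w. (?S w)\<^sup>2) \<le> a" using S2 by simp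
  have S1: "integrable P ?S" using Z1 by auto
  \<comment> \<open>The event \<open>D\<close> is measurable only for the completion, so the moments
    are transferred there.\<close>
  have C: "integrable (completion P) (\<lambda>w. (?S w)\<^sup>2)" "integrable (completion P) ?S"
    "(\<integral>w. (?S w)\<^sup>2 \<partial>completion P) \<le> a"
    using S2 S1 Sa integrable_completion[of "\<lambda>w. (?S w)\<^sup>2" P] integrable_completion[of "?S" P]
      integral_completion[of "\<lambda>w. (?S w)\<^sup>2" P] by (auto dest: borel_measurable_integrable)
  have n\<mu>: "real n * \<mu> = sqrt (2 * a * real n / pi)"
  proof -
    have "real n * \<mu> = sqrt (real n * real n) * (sqrt (a / real n) * sqrt (2 / pi))"
      by (simp add: \<mu>_def \<sigma>_def)
    also have "\<dots> = sqrt (2 * a * real n / pi)"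
      using n by (simp only: real_sqrt_mult[symmetric]) (simp add: field_simps)
    finally show ?thesis .
  qed
  have eq: "(\<Sum>i<n. \<bar>X i w\<bar>) = real n * \<mu> + ?S w" for w
    by (simp add: Z_def sum_subtractf)
  have iS: "integrable (completion P) (\<lambda>w. indicator D w * ?S w)"
    using integrable_mult_indicator[OF D C(2)] by simp
  have iD: "integrable (completion P) (indicator D :: _ \<Rightarrow> real)"
    using D by (simp add: C.emeasure_eq_measure)
  have "- ((1 + a) / 2) \<le> (\<integral>w. - ((1 + (?S w)\<^sup>2) / 2) \<partial>completion P)"
    using C by (simp add: prob_space)
  also have "\<dots> \<le> (\<integral>w. indicator D w * ?S w \<partial>completion P)"
  proof (rule integral_mono[OF _ iS])
    show "integrable (completion P) (\<lambda>w. - ((1 + (?S w)\<^sup>2) / 2))" using C by simp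
    show "- ((1 + (?S w)\<^sup>2) / 2) \<le> indicator D w * ?S w" for w
    proof -
      \<comment> \<open>Here \<open>c\<close> is the indicator value, \<open>y\<close> the sum and
        \<open>z\<close> its square. The last premise is the nonnegativity of
        \<open>(1 + y)^2\<close>.\<close>
      have *: "- ((1 + z) / 2) \<le> c * y" if "c = 0 \<or> c = 1" "0 \<le> z" "0 \<le> 1 + 2 * y + z"
        for c y z :: real using that by (auto simp: field_simps)
      show ?thesis
        using zero_le_power2[of "1 + ?S w"]
        by (intro *) (simp_all add: indicator_def power2_sum add_ac)
    qed
  qed
  finally have low: "- ((1 + a) / 2) \<le> (\<integral>w. indicator D w * ?S w \<partial>completion P)" .
  have "(\<integral>w. indicator D w * (\<Sum>i<n. \<bar>X i w\<bar>) \<partial>completion P) =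
    (\<integral>w. indicator D w * (real n * \<mu>) + indicator D w * ?S w \<partial>completion P)"
    by (simp add: eq distrib_left)
  also have "\<dots> = C.prob D * (real n * \<mu>) + (\<integral>w. indicator D w * ?S w \<partial>completion P)"
    using iS iD sets.Int_space_eq2[OF D] by simp
  finally show ?thesis using low unfolding n\<mu> X_def by simp
qed

section \<open>Contradiction in the anticipating filtration\<close>

theorem proposition1:
  fixes P :: "(real \<Rightarrow> real) measure" and a :: real
  assumes "a > 0"
    and "wiener_measure P"
  shows "\<not> semimartingale (completion P)
    (\<lambda>t. usual_augmentation P (natural_filtration (space P) canonical_process) (t + a))
    canonical_process"
proof
  let ?N = "natural_filtration (space P) canonical_process"
  let ?F = "\<lambda>t. usual_augmentation P ?N (t + a)"
  assume semi: "semimartingale (completion P) ?F canonical_process"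
  interpret P: prob_space P using assms(2) by (simp add: wiener_measure_def)
  interpret prob_space "completion P" by (rule P.prob_space_completion)
  have filt: "sets (?F s) \<subseteq> sets (?F t)" if "s \<le> t" for s t
    using anticipating_filtration(1)[OF assms(2), of a] that by (simp add: filtration_def)
  \<comment> \<open>\<open>?F 0\<close> is the augmentation at index \<open>a\<close>, hence
    contains the natural filtration up to \<open>a\<close>.\<close>
  have foreseen: "canonical_process t \<in> borel_measurable (?F 0)" if "0 \<le> t" "t \<le> a" for t
  proof -
    have "sets (?N t) \<subseteq> sets (?F 0)"
      using sets_natural_filtration_mono[OF that(2), of "space P" canonical_process]
        sets_subset_usual_augmentation[of ?N P a, OF _ sets_natural_filtration_mono] by force
    then show ?thesis
      using natural_filtration_adapted[OF that(1), of canonical_process "space P"]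
      by (auto simp: measurable_def)
  qed
  have cont: "continuous_on {0..a} (\<lambda>t. canonical_process t w)" if "w \<in> space (completion P)" for w
    using that assms(2)
    by (auto simp: wiener_space path_space_def canonical_process_def intro: continuous_on_subset)
  obtain D C where D: "D \<in> sets (completion P)" "0 < prob D"
    and C: "\<And>n. 0 < n \<Longrightarrow> expectation (\<lambda>w. indicator D w *
      (\<Sum>i<n. \<bar>canonical_process (a * real (Suc i) / real n) w
        - canonical_process (a * real i / real n) w\<bar>)) \<le> C"
    using foreseen_semimartingale_variation_bound[OF assms(1)
        anticipating_filtration(2)[OF assms(2)] filt foreseen cont semi] by blast
  have upper: "prob D * sqrt (2 * a * real n / pi) \<le> C + (1 + a) / 2" if "0 < n" for n
    using wiener_abs_increments_lower_bound[OF assms(2,1) that D(1)] C[OF that] by linarith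
  \<comment> \<open>Positivity of \<open>prob D\<close> turns the square root growth into a
    contradiction with the fixed bound.\<close>
  have "filterlim (\<lambda>n. prob D * sqrt (2 * a * real n / pi)) at_top sequentially"
    using D(2) assms(1) by real_asymp
  then have "eventually (\<lambda>n. C + (1 + a) / 2 < prob D * sqrt (2 * a * real n / pi) \<and> 0 < n) sequentially"
    by (intro eventually_conj eventually_gt_at_top) (simp add: filterlim_at_top_dense)
  then obtain n where "C + (1 + a) / 2 < prob D * sqrt (2 * a * real n / pi)" "0 < n"
    using eventually_happens'[OF sequentially_bot] by blast
  with upper[of n] show False by simp
qed

end
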